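(* Let $\Omega\subset\mathbb{R}^n$ be an open and bounded domain which admits a perimeter bound for its inner parallel bodies. Let $d(x)=\operatorname{dist}(x,\partial\Omega)$ and $r=\max_{x\in\Omega}d(x)$. Let $t_*>0$ and let $g$ be a solution on $[0,t_*]$ of $$g'(t)=\frac{g(t)^2}{I_2(g(t))},\quad t>0,\qquad g(0)=0,$$ such that the function $$u(t,x)=\begin{cases}\min\left(\dfrac{1}{g(t)}d(x),\,r\right), & 0\le t<t_*,\\[2mm] \dfrac{1}{\|d\|_2^2}\left(\|d\|_2^2+t_*-t\right)_+ d(x), & t\ge t_*,\end{cases}$$ solves the gradient flow $u'(t)+\partial\mathcal{J}(u(t))\ni 0$, $u(0)=f$ with $f\equiv r$. Then the level sets $\Gamma_c(t)=\{x\in\Omega: u(t,x)=c\}$ of $u(t)$ at level $c\ge 0$ and time $0\le t\le t_*$ are given by $$\Gamma_c(t)=\{x\in\Omega: d(x)=c\,g(t)\},\quad 0\le c<r,\qquad \Gamma_r(t)=\{x\in\Omega: d(x)\ge r\,g(t)\}.$$ This means that the level sets are inner parallel sets of $\partial\Omega$ moving with a velocity that is proportional to both the level $c$ and the function $g'(t)$, where $g'(t)\approx 1/\sqrt{t}$ for small $t$.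
   Context: Inner parallel bodies: $\Omega_\tau=\{x\in\Omega: d(x)\ge\tau\}$; $P(\cdot)$ denotes the perimeter. $\Omega$ admits a perimeter bound for its inner parallel bodies if there are $\tilde r>0$ and $0<\tilde\tau\le\tilde r$ with $P(\Omega_\tau)\ge P(\Omega)\left(1-\frac{\tau}{\tilde r}\right)^{n-1}$ for all $0\le\tau\le\tilde\tau$. $I_2(g)=\int_{\Omega\setminus\Omega_{rg}}d(x)^2\,\mathrm{d}x$ for $0\le g\le 1$. $(a)_+=\max(a,0)$. At $t=0$ the formula is understood as $u(0,x)=r$ for $x\in\Omega$. $W^{1,\infty}_0(\Omega)=\{u\in W^{1,\infty}(\Omega): u=0\text{ on }\partial\Omega\}$; $\mathcal{J}:L^2(\Omega)\to[0,\infty]$ is $\mathcal{J}(u)=\|\nabla u\|_\infty$ if $u\in W^{1,\infty}_0(\Omega)$ and $+\infty$ otherwise; $\partial\mathcal{J}$ is its convex subdifferential in $L^2(\Omega)$, and the gradient flow is understood in $L^2(\Omega)$.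
   Formalization: The closing remark g'(t) ≈ 1/√t is read as two-sided bounds up to constants and is stated only when the volume of Ω∖Ω_s is O(s) as s→0; without this it fails, e.g. for a disc minus a countable compact set of box dimension 3/2. *)

theory Defs
  imports
    "HOL-Analysis.Analysis"
    "HOL-Probability.Essential_Supremum"
    "HOL-Library.Landau_Symbols"
begin

section \<open>Distance function, inner parallel sets, perimeter\<close>

definition bdist :: "(real^'n) set \<Rightarrow> real^'n \<Rightarrow> real" where
  "bdist \<Omega> x = infdist x (frontier \<Omega>)"

text \<open>For open, bounded, nonempty sets the supremum is attained.\<close>

definition inradius :: "(real^'n) set \<Rightarrow> real" where
  "inradius \<Omega> = (SUP x\<in>\<Omega>. bdist \<Omega> x)"

definition inner_parallel :: "(real^'n) set \<Rightarrow> real \<Rightarrow> (real^'n) set" where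
  "inner_parallel \<Omega> \<tau> = {x \<in> \<Omega>. \<tau> \<le> bdist \<Omega> x}"

text \<open>The De Giorgi perimeter of \<open>E\<close> in the whole space. A competitor is a compactly supported
  \<open>C\<^sup>1\<close> vector field \<open>\<phi>\<close>, given with its Jacobian matrix \<open>J\<close>; its divergence is the trace of \<open>J\<close>.\<close>

definition perimeter_fields :: "((real^'n \<Rightarrow> real^'n) \<times> (real^'n \<Rightarrow> real^'n^'n)) set" where
  "perimeter_fields = {(\<phi>, J).
     (\<forall>x. (\<phi> has_derivative (\<lambda>h. J x *v h)) (at x)) \<and> continuous_on UNIV J \<and>
     compact (closure {x. \<phi> x \<noteq> 0}) \<and> (\<forall>x. norm (\<phi> x) \<le> 1)}"

definition perimeter :: "(real^'n) set \<Rightarrow> ereal" where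
  "perimeter E = (SUP (\<phi>, J)\<in>perimeter_fields. ereal (LINT x:E|lebesgue. trace (J x)))"

definition admits_perimeter_bound :: "(real^'n) set \<Rightarrow> bool" where
  "admits_perimeter_bound \<Omega> \<longleftrightarrow>
     (\<exists>r' \<tau>'. 0 < r' \<and> 0 < \<tau>' \<and> \<tau>' \<le> r' \<and>
        (\<forall>\<tau>\<in>{0..\<tau>'}. perimeter (inner_parallel \<Omega> \<tau>)
           \<ge> perimeter \<Omega> * ereal ((1 - \<tau> / r') ^ (CARD('n) - 1))))"

definition I2 :: "(real^'n) set \<Rightarrow> real \<Rightarrow> real" where
  "I2 \<Omega> g = (LINT x:(\<Omega> - inner_parallel \<Omega> (inradius \<Omega> * g))|lebesgue. (bdist \<Omega> x)\<^sup>2)"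


section \<open>The space \<open>L\<^sup>2(\<Omega>)\<close>\<close>

text \<open>Elements of \<open>L\<^sup>2(\<Omega>)\<close> are represented by functions on the whole space of which only the values
  on \<open>\<Omega>\<close> matter; all notions below are invariant under changes on null sets of \<open>\<Omega>\<close>.\<close>

definition L2 :: "(real^'n) set \<Rightarrow> (real^'n \<Rightarrow> real) set" where
  "L2 \<Omega> = {u. u \<in> borel_measurable (lebesgue_on \<Omega>) \<and> integrable (lebesgue_on \<Omega>) (\<lambda>x. (u x)\<^sup>2)}"

definition L2_inner :: "(real^'n) set \<Rightarrow> (real^'n \<Rightarrow> real) \<Rightarrow> (real^'n \<Rightarrow> real) \<Rightarrow> real" where
  "L2_inner \<Omega> u v = (\<integral>x. u x * v x \<partial>lebesgue_on \<Omega>)"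

definition L2_norm :: "(real^'n) set \<Rightarrow> (real^'n \<Rightarrow> real) \<Rightarrow> real" where
  "L2_norm \<Omega> u = sqrt (L2_inner \<Omega> u u)"


section \<open>The space \<open>W\<^sub>0\<^sup>1\<^sup>,\<^sup>\<infinity>(\<Omega>)\<close> and the functional\<close>

text \<open>\<open>C\<^sup>1\<close> test functions with compact support in \<open>\<Omega>\<close>, given with their gradients. By mollification
  they yield the same weak gradients as smooth test functions.\<close>

definition test_functions :: "(real^'n) set \<Rightarrow> ((real^'n \<Rightarrow> real) \<times> (real^'n \<Rightarrow> real^'n)) set" where
  "test_functions \<Omega> = {(\<phi>, D).
     (\<forall>x. GDERIV \<phi> x :> D x) \<and> continuous_on UNIV D \<and>
     compact (closure {x. \<phi> x \<noteq> 0}) \<and> closure {x. \<phi> x \<noteq> 0} \<subseteq> \<Omega>}"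

definition has_weak_gradient ::
    "(real^'n) set \<Rightarrow> (real^'n \<Rightarrow> real) \<Rightarrow> (real^'n \<Rightarrow> real^'n) \<Rightarrow> bool" where
  "has_weak_gradient \<Omega> u G \<longleftrightarrow>
     (\<forall>K. compact K \<and> K \<subseteq> \<Omega> \<longrightarrow> set_integrable lebesgue K u \<and> set_integrable lebesgue K G) \<and>
     (\<forall>(\<phi>, D)\<in>test_functions \<Omega>.
        (LINT x:\<Omega>|lebesgue. u x *\<^sub>R D x) = - (LINT x:\<Omega>|lebesgue. \<phi> x *\<^sub>R G x))"

definition weak_gradient :: "(real^'n) set \<Rightarrow> (real^'n \<Rightarrow> real) \<Rightarrow> real^'n \<Rightarrow> real^'n" where
  "weak_gradient \<Omega> u = (SOME G. has_weak_gradient \<Omega> u G)"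

definition W1inf :: "(real^'n) set \<Rightarrow> (real^'n \<Rightarrow> real) set" where
  "W1inf \<Omega> = {u. u \<in> borel_measurable (lebesgue_on \<Omega>) \<and>
     (\<exists>C. AE x in lebesgue_on \<Omega>. \<bar>u x\<bar> \<le> C) \<and>
     (\<exists>G. has_weak_gradient \<Omega> u G \<and> (\<exists>C. AE x in lebesgue_on \<Omega>. norm (G x) \<le> C))}"

text \<open>The boundary condition refers to the continuous representative on the closure of \<open>\<Omega>\<close>.\<close>

definition W01inf :: "(real^'n) set \<Rightarrow> (real^'n \<Rightarrow> real) set" where
  "W01inf \<Omega> = {u \<in> W1inf \<Omega>. \<exists>w. continuous_on (closure \<Omega>) w \<and>
     (AE x in lebesgue_on \<Omega>. u x = w x) \<and> (\<forall>x\<in>frontier \<Omega>. w x = 0)}"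

definition J_functional :: "(real^'n) set \<Rightarrow> (real^'n \<Rightarrow> real) \<Rightarrow> ereal" where
  "J_functional \<Omega> u =
     (if u \<in> W01inf \<Omega> then esssup (lebesgue_on \<Omega>) (\<lambda>x. ereal (norm (weak_gradient \<Omega> u x))) else \<infinity>)"


section \<open>Subdifferential and gradient flow in \<open>L\<^sup>2(\<Omega>)\<close>\<close>

definition subdifferential ::
    "(real^'n) set \<Rightarrow> ((real^'n \<Rightarrow> real) \<Rightarrow> ereal) \<Rightarrow> (real^'n \<Rightarrow> real) \<Rightarrow> (real^'n \<Rightarrow> real) set" where
  "subdifferential \<Omega> F u =
     {\<zeta> \<in> L2 \<Omega>. \<forall>v\<in>L2 \<Omega>. F u + ereal (L2_inner \<Omega> \<zeta> (\<lambda>x. v x - u x)) \<le> F v}"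

definition L2_continuous_on ::
    "(real^'n) set \<Rightarrow> real set \<Rightarrow> (real \<Rightarrow> real^'n \<Rightarrow> real) \<Rightarrow> bool" where
  "L2_continuous_on \<Omega> T u \<longleftrightarrow>
     (\<forall>t\<in>T. ((\<lambda>s. L2_norm \<Omega> (\<lambda>x. u s x - u t x)) \<longlongrightarrow> 0) (at t within T))"

definition L2_absolutely_continuous_on ::
    "(real^'n) set \<Rightarrow> real set \<Rightarrow> (real \<Rightarrow> real^'n \<Rightarrow> real) \<Rightarrow> bool" where
  "L2_absolutely_continuous_on \<Omega> T u \<longleftrightarrow>
     (\<forall>\<epsilon>>0. \<exists>\<delta>>0. \<forall>P. finite P \<and> (\<forall>(a, b)\<in>P. a \<le> b \<and> a \<in> T \<and> b \<in> T) \<and>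
        disjoint_family_on (\<lambda>(a, b). {a<..<b}) P \<and> (\<Sum>(a, b)\<in>P. b - a) < \<delta>
        \<longrightarrow> (\<Sum>(a, b)\<in>P. L2_norm \<Omega> (\<lambda>x. u b x - u a x)) < \<epsilon>)"

definition has_L2_derivative ::
    "(real^'n) set \<Rightarrow> (real \<Rightarrow> real^'n \<Rightarrow> real) \<Rightarrow> (real^'n \<Rightarrow> real) \<Rightarrow> real \<Rightarrow> bool" where
  "has_L2_derivative \<Omega> u v t \<longleftrightarrow> v \<in> L2 \<Omega> \<and>
     ((\<lambda>s. L2_norm \<Omega> (\<lambda>x. (u s x - u t x) / (s - t) - v x)) \<longlongrightarrow> 0) (at t)"

text \<open>Strong solutions in the sense of Brezis of \<open>u'(t) + \<partial>F(u(t)) \<ni> 0\<close>, \<open>u(0) = f\<close>.\<close>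

definition solves_gradient_flow ::
    "(real^'n) set \<Rightarrow> ((real^'n \<Rightarrow> real) \<Rightarrow> ereal) \<Rightarrow> (real^'n \<Rightarrow> real) \<Rightarrow> (real \<Rightarrow> real^'n \<Rightarrow> real) \<Rightarrow> bool" where
  "solves_gradient_flow \<Omega> F f u \<longleftrightarrow>
     (\<forall>t\<ge>0. u t \<in> L2 \<Omega>) \<and>
     L2_continuous_on \<Omega> {0..} u \<and>
     (\<forall>a b. 0 < a \<and> a \<le> b \<longrightarrow> L2_absolutely_continuous_on \<Omega> {a..b} u) \<and>
     (AE x in lebesgue_on \<Omega>. u 0 x = f x) \<and>
     (AE t in lebesgue_on {0<..}. \<exists>v. has_L2_derivative \<Omega> u v t \<and>
        (\<lambda>x. - v x) \<in> subdifferential \<Omega> F (u t))"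


section \<open>The explicit solution\<close>

text \<open>\<open>g\<close> is a solution on \<open>[0, t\<^sub>*]\<close> of \<open>g' = g\<^sup>2 / I2(g)\<close>, \<open>g(0) = 0\<close>, with derivative \<open>g'\<close>
  (one-sided at \<open>t\<^sub>*\<close>). The condition \<open>I2 \<Omega> (g t) \<noteq> 0\<close> makes the right-hand side meaningful and
  excludes \<open>g = 0\<close>, which would satisfy the equation due to the convention \<open>0 / 0 = 0\<close>.\<close>

definition solves_ode ::
    "(real^'n) set \<Rightarrow> real \<Rightarrow> (real \<Rightarrow> real) \<Rightarrow> (real \<Rightarrow> real) \<Rightarrow> bool" where
  "solves_ode \<Omega> ts g g' \<longleftrightarrow>
     g 0 = 0 \<and> continuous_on {0..ts} g \<and>
     (\<forall>t\<in>{0..ts}. 0 \<le> g t \<and> g t \<le> 1) \<and>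
     (\<forall>t\<in>{0<..ts}. I2 \<Omega> (g t) \<noteq> 0 \<and>
        (g has_real_derivative g' t) (at t within {0..ts}) \<and>
        g' t = (g t)\<^sup>2 / I2 \<Omega> (g t))"

definition flow :: "(real^'n) set \<Rightarrow> real \<Rightarrow> (real \<Rightarrow> real) \<Rightarrow> real \<Rightarrow> real^'n \<Rightarrow> real" where
  "flow \<Omega> ts g t x =
     (if t = 0 then inradius \<Omega>
      else if t < ts then min (1 / g t * bdist \<Omega> x) (inradius \<Omega>)
      else 1 / (L2_norm \<Omega> (bdist \<Omega>))\<^sup>2 * max 0 ((L2_norm \<Omega> (bdist \<Omega>))\<^sup>2 + ts - t) * bdist \<Omega> x)"

definition level_set :: "(real^'n) set \<Rightarrow> (real^'n \<Rightarrow> real) \<Rightarrow> real \<Rightarrow> (real^'n) set" where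
  "level_set \<Omega> w c = {x \<in> \<Omega>. w x = c}"

end

theory Submission
  imports Defs
begin

text \<open>Continuity of the flow in \<open>L\<^sup>2\<close> at \<open>t\<^sub>*\<close> forces \<open>g(t\<^sub>*) = 1\<close>, after which the level sets are read
  off from the formula. For the asymptotics, \<open>g g' = g\<^sup>3 / I\<^sub>2(g)\<close> has to be bounded between positive
  constants near \<open>0\<close>. The assumed bound on \<open>|\<Omega> - \<Omega>\<^sub>s|\<close> gives \<open>I\<^sub>2(g) \<le> C g\<^sup>3\<close>. The reverse estimate
  needs no regularity of \<open>\<Omega>\<close>: every ray in a fixed direction that starts deep inside \<open>\<Omega>\<close> spends at
  least time \<open>s/2\<close> in the shell \<open>s/2 < d < s\<close> before it leaves \<open>\<Omega>\<close>, so by Tonelli the shell has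
  measure at least \<open>c s\<close>.\<close>

section \<open>Preliminaries: translation invariance, and growth of \<open>g'\<close> near 0\<close>

lemma emeasure_lborel_plus_vimage:
  fixes A :: "'a::euclidean_space set"
  assumes "A \<in> sets borel"
  shows "(\<integral>\<^sup>+x. indicator A (x + a) \<partial>lborel) = emeasure lborel A"
proof -
  have "emeasure lborel A = (\<integral>\<^sup>+x. indicator A x \<partial>distr lborel borel ((+) a))"
    using assms by (simp add: lborel_distr_plus)
  also have "\<dots> = (\<integral>\<^sup>+x. indicator A (x + a) \<partial>lborel)"
    using assms by (subst nn_integral_distr) (auto simp: add.commute)
  finally show ?thesis by simp
qed

text \<open>The derivative \<open>2 * (g * g')\<close> of the square of \<open>g\<close> lies
  between \<open>2 * p\<close> and \<open>2 * q\<close>, so \<open>g\<close> is comparable to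
  \<open>sqrt t\<close>. Dividing \<open>g * g'\<close>, which is comparable to 1, by
  \<open>g\<close> gives the claim.\<close>

lemma bigtheta_inverse_sqrt_of_ode:
  fixes g g' :: "real \<Rightarrow> real"
  assumes T: "0 < T" and cont: "continuous_on {0..T} g" and g0: "g 0 = 0"
    and pos: "\<And>t. 0 < t \<Longrightarrow> t < T \<Longrightarrow> 0 < g t"
    and der: "\<And>t. 0 < t \<Longrightarrow> t < T \<Longrightarrow> (g has_real_derivative g' t) (at t)"
    and p: "0 < p" and lo: "\<And>t. 0 < t \<Longrightarrow> t < T \<Longrightarrow> p \<le> g t * g' t"
    and up: "\<And>t. 0 < t \<Longrightarrow> t < T \<Longrightarrow> g t * g' t \<le> q"
  shows "g' \<in> \<Theta>[at_right 0](\<lambda>t. 1 / sqrt t)"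
proof -
  have q: "0 < q" using p lo[of "T/2"] up[of "T/2"] T by force
  have sq: "2 * p * t \<le> (g t)\<^sup>2 \<and> (g t)\<^sup>2 \<le> 2 * q * t" if t: "0 < t" "t < T" for t
  proof -
    have d: "((\<lambda>x. (g x)\<^sup>2) has_real_derivative 2 * (g x * g' x)) (at x)" if "0 < x" "x < t" for x
      using that t by (auto intro!: derivative_eq_intros der)
    have c: "continuous_on {0..t} (\<lambda>x. (g x)\<^sup>2)"
      using t by (intro continuous_intros continuous_on_subset[OF cont]) auto
    obtain l z where z: "0 < z" "z < t" "((\<lambda>x. (g x)\<^sup>2) has_real_derivative l) (at z)"
        "(g t)\<^sup>2 - (g 0)\<^sup>2 = (t - 0) * l"
      using MVT[OF t(1) c] d real_differentiable_def by blast
    have l: "l = 2 * (g z * g' z)" using d[OF z(1,2)] z(3) by (rule DERIV_unique[symmetric])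
    have "p \<le> g z * g' z" "g z * g' z \<le> q" using lo up z t by auto
    then have "t * (2 * p) \<le> t * l" "t * l \<le> t * (2 * q)"
      using t l by (auto intro!: mult_left_mono)
    then show ?thesis using z(4) g0 by (simp add: mult.commute mult.left_commute)
  qed
  have ev: "eventually (\<lambda>t. 0 < t \<and> t < T) (at_right 0)"
    using T by (auto simp: eventually_at_right[OF T])
  \<comment> \<open>Both constants come from dividing the bounds \<open>p\<close> and
    \<open>q\<close> for \<open>g t * g' t\<close> by the opposite bounds
    \<open>sqrt (2*q) * sqrt t\<close> and \<open>sqrt (2*p) * sqrt t\<close> for
    \<open>g t\<close>.\<close>
  have bds: "norm (g' t) \<le> (q / sqrt (2*p)) * norm (1 / sqrt t)
      \<and> norm (1 / sqrt t) \<le> (sqrt (2*q) / p) * norm (g' t)" if t: "0 < t \<and> t < T" for t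
  proof -
    have g: "0 < g t" "sqrt (2*p) * sqrt t \<le> g t" "g t \<le> sqrt (2*q) * sqrt t"
      using sq[of t] pos[of t] t p q
      by (auto simp: real_sqrt_mult[symmetric] intro: real_le_lsqrt real_le_rsqrt)
    have gg: "p \<le> g t * g' t" "g t * g' t \<le> q" using lo up t by auto
    have g'p: "0 < g' t" using gg(1) g(1) p by (smt (verit) zero_less_mult_pos)
    have "sqrt (2*p) * sqrt t * g' t \<le> q"
      using mult_right_mono[OF g(2), of "g' t"] g'p gg by linarith
    moreover have "p \<le> sqrt (2*q) * sqrt t * g' t"
      using mult_right_mono[OF g(3), of "g' t"] g'p gg by linarith
    ultimately show ?thesis using g'p p q t by (auto simp: field_simps)
  qed
  show ?thesis
  proof (rule bigthetaI)
    show "g' \<in> O[at_right 0](\<lambda>t. 1 / sqrt t)"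
      using bds by (intro bigoI[where c = "q / sqrt (2*p)"] eventually_mono[OF ev]) blast
    have "(\<lambda>t. 1 / sqrt t) \<in> O[at_right 0](g')"
      using bds by (intro bigoI[where c = "sqrt (2*q) / p"] eventually_mono[OF ev]) blast
    then show "g' \<in> \<Omega>[at_right 0](\<lambda>t. 1 / sqrt t)"
      by (simp add: bigomega_iff_bigo)
  qed
qed

section \<open>The distance function of a bounded domain\<close>

locale bounded_domain =
  fixes \<Omega> :: "(real^'n) set"
  assumes open_domain: "open \<Omega>" and bounded_domain: "bounded \<Omega>"
    and connected_domain: "connected \<Omega>" and domain_nonempty: "\<Omega> \<noteq> {}"
begin

text \<open>\<open>infdist\<close> to the empty set is 0 by convention, so positivity of
  \<open>bdist\<close> inside \<Omega> rests on this.\<close>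

lemma frontier_nonempty: "frontier \<Omega> \<noteq> {}"
  using bounded_domain domain_nonempty by (auto simp: frontier_eq_empty)

lemma bdist_pos: "x \<in> \<Omega> \<Longrightarrow> 0 < bdist \<Omega> x"
  unfolding bdist_def using frontier_disjoint_eq open_domain frontier_nonempty
  by (intro infdist_pos_not_in_closed) auto

lemma bdist_frontier: "x \<in> frontier \<Omega> \<Longrightarrow> bdist \<Omega> x = 0"
  by (simp add: bdist_def)

lemma bdist_lipschitz: "\<bar>bdist \<Omega> x - bdist \<Omega> y\<bar> \<le> dist x y"
  unfolding bdist_def by (rule infdist_triangle_abs)

lemma continuous_bdist: "continuous_on S (bdist \<Omega>)"
  unfolding bdist_def[abs_def] by (intro continuous_intros)

text \<open>The maximum over the compact closure is positive, while \<open>bdist\<close> vanishes on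
  the frontier; so the maximiser lies in \<Omega>.\<close>

lemma inradius_attained: "\<exists>x\<in>\<Omega>. bdist \<Omega> x = inradius \<Omega> \<and> (\<forall>y\<in>\<Omega>. bdist \<Omega> y \<le> bdist \<Omega> x)"
proof -
  have "compact (closure \<Omega>)" "closure \<Omega> \<noteq> {}"
    using bounded_domain domain_nonempty by (auto simp: compact_closure)
  then obtain x where x: "x \<in> closure \<Omega>" "\<And>y. y \<in> closure \<Omega> \<Longrightarrow> bdist \<Omega> y \<le> bdist \<Omega> x"
    using continuous_attains_sup[OF _ _ continuous_bdist] by metis
  obtain z where "z \<in> \<Omega>" using domain_nonempty by auto
  then have "0 < bdist \<Omega> x" using x(2)[of z] bdist_pos[of z] closure_subset by fastforce
  then have "x \<in> \<Omega>"
    using x(1) bdist_frontier[of x] open_domain by (auto simp: frontier_def interior_open)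
  moreover have le: "\<forall>y\<in>\<Omega>. bdist \<Omega> y \<le> bdist \<Omega> x"
    using x(2) closure_subset by auto
  moreover have "inradius \<Omega> = bdist \<Omega> x"
    unfolding inradius_def using \<open>x \<in> \<Omega>\<close> le by (intro cSup_eq_maximum) auto
  ultimately show ?thesis by auto
qed

lemma bdist_le_inradius: "x \<in> \<Omega> \<Longrightarrow> bdist \<Omega> x \<le> inradius \<Omega>"
  using inradius_attained by auto

lemma inradius_pos: "0 < inradius \<Omega>"
  using inradius_attained bdist_pos by metis

text \<open>Connectedness enters here: on the connected closure \<open>bdist\<close> takes the
  values 0 and \<open>inradius \<Omega>\<close>, hence everything between. A point with
  \<open>v > 0\<close> cannot lie on the frontier.\<close>

lemma bdist_surj:
  assumes "0 < v" "v \<le> inradius \<Omega>"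
  shows "\<exists>x\<in>\<Omega>. bdist \<Omega> x = v"
proof -
  obtain x where x: "x \<in> \<Omega>" "bdist \<Omega> x = inradius \<Omega>" using inradius_attained by auto
  obtain y where y: "y \<in> frontier \<Omega>" using frontier_nonempty by auto
  have "connected (bdist \<Omega> ` closure \<Omega>)"
    by (intro connected_continuous_image continuous_bdist connected_imp_connected_closure
        connected_domain)
  moreover have "0 \<in> bdist \<Omega> ` closure \<Omega>"
    using y bdist_frontier by (force simp: frontier_def)
  moreover have "inradius \<Omega> \<in> bdist \<Omega> ` closure \<Omega>"
    using x closure_subset by force
  ultimately have "v \<in> bdist \<Omega> ` closure \<Omega>"
    by (rule connectedD_interval) (use assms in auto)
  then obtain z where z: "z \<in> closure \<Omega>" "bdist \<Omega> z = v" by auto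
  then have "z \<notin> frontier \<Omega>" using bdist_frontier[of z] assms(1) by force
  then have "z \<in> \<Omega>" using z(1) open_domain by (simp add: frontier_def interior_open)
  then show ?thesis using z by auto
qed

text \<open>Serves both kinds of level sets, those with depth equal to \<open>v\<close> and those
  with depth at least \<open>v\<close>: the infimum of the depths over \<open>L\<close> is attained
  and equals \<open>v\<close>.\<close>

lemma setdist_frontier_eq:
  assumes "\<And>x. x \<in> L \<Longrightarrow> v \<le> bdist \<Omega> x" and "\<exists>x\<in>L. bdist \<Omega> x = v"
  shows "setdist L (frontier \<Omega>) = v"
proof -
  have "L \<noteq> {}" using assms(2) by blast
  moreover have "(INF x\<in>L. infdist x (frontier \<Omega>)) = v"
    using assms unfolding bdist_def by (intro cInf_eq_minimum) blast+
  ultimately show ?thesis by (simp add: setdist_eq_infdist)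
qed

text \<open>Needed at time 0 for the level \<open>r\<close>, whose level set is all of \<Omega>. The
  distance 0 is not attained in \<Omega>, but \<open>setdist\<close> does not change under
  closure.\<close>

lemma setdist_domain_frontier: "setdist \<Omega> (frontier \<Omega>) = 0"
proof -
  obtain y where "y \<in> frontier \<Omega>" using frontier_nonempty by auto
  then have "setdist (closure \<Omega>) (frontier \<Omega>) = 0"
    by (intro setdist_eq_0I[of y]) (auto simp: frontier_def)
  then show ?thesis by simp
qed

lemma open_bdist_between: "open {x\<in>\<Omega>. a < bdist \<Omega> x \<and> bdist \<Omega> x < b}"
proof -
  have "open (\<Omega> \<inter> bdist \<Omega> -` {a<..<b})"
    by (rule continuous_open_preimage[OF continuous_bdist open_domain]) auto
  then show ?thesis by (simp add: Int_def)
qed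

text \<open>The lower bound 0 gives the shell the form of \<open>open_bdist_between\<close>, which
  makes it open and hence measurable.\<close>

lemma shell_eq: "\<Omega> - inner_parallel \<Omega> s = {x\<in>\<Omega>. 0 < bdist \<Omega> x \<and> bdist \<Omega> x < s}"
  using bdist_pos by (auto simp: inner_parallel_def)

lemma lmeasurable_open_subset: "open V \<Longrightarrow> V \<subseteq> \<Omega> \<Longrightarrow> V \<in> lmeasurable"
  by (meson bounded_domain bounded_subset lmeasurable_open)

section \<open>Lower bounds for norms in \<open>L2\<close>\<close>

text \<open>Chebyshev's inequality for the square of \<open>f\<close>. The bound \<open>B\<close>
  provides integrability, without which the integral would be 0 by default.\<close>

lemma L2_norm_ge:
  assumes f: "continuous_on \<Omega> f" and B: "\<And>x. x \<in> \<Omega> \<Longrightarrow> \<bar>f x\<bar> \<le> B"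
    and V: "open V" "V \<subseteq> \<Omega>" and "0 \<le> \<delta>" and le: "\<And>x. x \<in> V \<Longrightarrow> \<delta> \<le> \<bar>f x\<bar>"
  shows "\<delta> * sqrt (measure lebesgue V) \<le> L2_norm \<Omega> f"
proof -
  have O: "\<Omega> \<in> sets lebesgue" using open_domain by simp
  have Of: "\<Omega> \<in> lmeasurable" using lmeasurable_open_subset open_domain by blast
  have VM: "V \<in> sets (lebesgue_on \<Omega>)"
    using V by (auto simp: sets_restrict_space_iff O)
  interpret finite_measure "lebesgue_on \<Omega>"
    using Of by (rule finite_measure_lebesgue_on)
  have sq: "(f x)\<^sup>2 \<le> B\<^sup>2" if "x \<in> \<Omega>" for x
    using power_mono[OF B[OF that], of 2] by simp
  have int: "integrable (lebesgue_on \<Omega>) (\<lambda>x. (f x)\<^sup>2)"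
  proof (rule integrable_const_bound[where B = "B\<^sup>2"])
    show "AE x in lebesgue_on \<Omega>. norm ((f x)\<^sup>2) \<le> B\<^sup>2"
      using sq by (intro AE_I2) auto
    show "(\<lambda>x. (f x)\<^sup>2) \<in> borel_measurable (lebesgue_on \<Omega>)"
      by (intro continuous_imp_measurable_on_sets_lebesgue continuous_intros f O)
  qed
  have "\<delta>\<^sup>2 * measure lebesgue V = (\<integral>x. \<delta>\<^sup>2 * indicator V x \<partial>lebesgue_on \<Omega>)"
    using VM V O by (simp add: measure_restrict_space Int_absorb2)
  also have "\<dots> \<le> (\<integral>x. (f x)\<^sup>2 \<partial>lebesgue_on \<Omega>)"
  proof (rule integral_mono[OF _ int])
    show "integrable (lebesgue_on \<Omega>) (\<lambda>x. \<delta>\<^sup>2 * indicator V x)"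
      using VM by (simp add: emeasure_eq_measure)
    show "\<delta>\<^sup>2 * indicator V x \<le> (f x)\<^sup>2" for x
      using power_mono[OF le, of x 2] \<open>0 \<le> \<delta>\<close> by (auto simp: indicator_def)
  qed
  finally have "sqrt (\<delta>\<^sup>2 * measure lebesgue V) \<le> L2_norm \<Omega> f"
    unfolding L2_norm_def L2_inner_def by (simp add: power2_eq_square)
  then show ?thesis using \<open>0 \<le> \<delta>\<close> by (simp add: real_sqrt_mult)
qed

lemma measure_open_pos:
  assumes "open V" "V \<subseteq> \<Omega>" "V \<noteq> {}"
  shows "0 < measure lebesgue V"
proof -
  have "measure lebesgue V \<noteq> 0"
    using open_not_negligible[OF assms(1,3)] lmeasurable_open_subset[OF assms(1,2)]
    by (simp add: negligible_iff_measure)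
  then show ?thesis by (simp add: zero_less_measure_iff)
qed

text \<open>Ensures that the second branch of \<open>flow\<close> does not divide by 0. The slice
  around depth \<open>?r/2\<close> is open and nonempty, so it contributes a positive
  amount.\<close>

lemma L2_norm_bdist_pos: "0 < L2_norm \<Omega> (bdist \<Omega>)"
proof -
  let ?r = "inradius \<Omega>"
  let ?V = "{x\<in>\<Omega>. ?r/4 < bdist \<Omega> x \<and> bdist \<Omega> x < 3 * ?r / 4}"
  have "?V \<noteq> {}" using bdist_surj[of "?r/2"] inradius_pos by force
  then have "0 < measure lebesgue ?V"
    by (intro measure_open_pos open_bdist_between) auto
  then have "0 < ?r/4 * sqrt (measure lebesgue ?V)" using inradius_pos by simp
  also have "\<dots> \<le> L2_norm \<Omega> (bdist \<Omega>)"
    using inradius_pos bdist_le_inradius bdist_pos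
    by (intro L2_norm_ge[where B = ?r] continuous_bdist open_bdist_between) (auto simp: abs_of_pos)
  finally show ?thesis .
qed

section \<open>Lower bound for the volume of a boundary shell\<close>

text \<open>A ray that starts at depth at least \<open>s\<close> passes the depth \<open>3s/4\<close> before it leaves \<open>\<Omega>\<close>; as
  \<open>d\<close> is 1-Lipschitz, it stays in the shell for time \<open>s/4\<close> before and after that.\<close>

lemma ray_in_shell:
  fixes e :: "real^'n"
  assumes e: "norm e = 1" and x: "x \<in> \<Omega>" and s: "0 < s" "s \<le> bdist \<Omega> x"
    and D: "0 \<le> D" "x + D *\<^sub>R e \<notin> \<Omega>"
  shows "\<exists>t1. {t1 - s/4<..<t1 + s/4} \<subseteq>
    {t. 0 \<le> t \<and> t \<le> D \<and> x + t *\<^sub>R e \<in> {x\<in>\<Omega>. s/2 < bdist \<Omega> x \<and> bdist \<Omega> x < s}}"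
proof -
  define p where "p t = x + t *\<^sub>R e" for t
  have pc: "continuous_on S p" for S unfolding p_def[abs_def] by (intro continuous_intros)
  have dp: "dist (p a) (p b) = \<bar>a - b\<bar>" for a b
    using e by (simp add: p_def dist_norm flip: scaleR_diff_left)
  \<comment> \<open>The least element \<open>T\<close> of this compact set is the first exit time of
    the ray.\<close>
  define Out where "Out = {0..D} \<inter> p -` (- \<Omega>)"
  have "closed Out" unfolding Out_def
    using open_domain by (intro continuous_closed_preimage pc) auto
  then have "compact Out" unfolding Out_def
    by (metis bounded_Int bounded_closed_interval compact_eq_bounded_closed box_real(2))
  moreover have "Out \<noteq> {}" using D by (auto simp: Out_def p_def)
  ultimately obtain T where T: "T \<in> Out" "\<And>t. t \<in> Out \<Longrightarrow> T \<le> t"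
    by (meson compact_attains_inf)
  have T0: "0 \<le> T" "T \<le> D" "p T \<notin> \<Omega>" using T(1) by (auto simp: Out_def)
  have inO: "p t \<in> \<Omega>" if "0 \<le> t" "t < T" for t
    using T(2)[of t] that T0 by (auto simp: Out_def)
  have "T > 0" using T0 x by (cases "T = 0") (auto simp: p_def)
  \<comment> \<open>The exit point is a limit of points of \<Omega> but lies outside the open set
    \<Omega>, so it is on the frontier and has depth 0.\<close>
  have "p T \<in> closure \<Omega>"
  proof -
    have "p ` closure {0..<T} \<subseteq> closure (p ` {0..<T})"
      by (intro image_closure_subset pc) (auto simp: closure_subset)
    moreover have "p ` {0..<T} \<subseteq> \<Omega>" using inO by auto
    moreover have "T \<in> closure {0..<T}" using \<open>T > 0\<close> by simp
    ultimately show ?thesis using closure_mono by blast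
  qed
  then have dT: "bdist \<Omega> (p T) = 0"
    using T0 open_domain by (intro bdist_frontier) (auto simp: frontier_def interior_open)
  have d0: "s \<le> bdist \<Omega> (p 0)" using s by (simp add: p_def)
  have "continuous_on {0..T} (\<lambda>t. bdist \<Omega> (p t))"
    using continuous_on_compose[OF pc continuous_bdist] by (simp add: o_def)
  then obtain t1 where t1: "0 \<le> t1" "t1 \<le> T" "bdist \<Omega> (p t1) = 3 * s / 4"
    using IVT2'[of "\<lambda>t. bdist \<Omega> (p t)" T "3 * s / 4" 0] s dT d0 T0 by auto
  \<comment> \<open>The depth changes at most at unit speed: falling from at least \<open>s\<close>
    to \<open>3 * s / 4\<close> takes time \<open>s/4\<close>, falling from there to 0 takes
    \<open>3 * s / 4\<close>.\<close>
  have a: "s/4 \<le> t1" "t1 + 3 * s / 4 \<le> T"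
    using bdist_lipschitz[of "p 0" "p t1"] bdist_lipschitz[of "p T" "p t1"] t1 dT d0 s
    unfolding dp by auto
  have "0 \<le> t \<and> t \<le> D \<and> p t \<in> \<Omega> \<and> s/2 < bdist \<Omega> (p t) \<and> bdist \<Omega> (p t) < s"
    if t: "t1 - s/4 < t" "t < t1 + s/4" for t
    using bdist_lipschitz[of "p t" "p t1"] t a t1 T0 s inO[of t] unfolding dp by auto
  then show ?thesis unfolding p_def by (intro exI[of _ t1]) auto
qed

text \<open>Double counting of pairs \<open>(x, t)\<close> with \<open>x\<close> in a deep set
  \<open>Q\<close> and \<open>x + t *\<^sub>R e\<close> in the shell \<open>A\<close>. Each
  \<open>x\<close> has at least time \<open>s/2\<close>, each \<open>t\<close> in
  \<open>{0..D}\<close> at most the measure of \<open>A\<close>. So \<open>s/2\<close> times the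
  measure of \<open>Q\<close> is at most \<open>D\<close> times that of \<open>A\<close>.\<close>

lemma measure_shell_ge:
  "\<exists>c>0. \<forall>s. 0 < s \<and> s \<le> inradius \<Omega> / 2 \<longrightarrow>
     c * s \<le> measure lebesgue {x\<in>\<Omega>. s/2 < bdist \<Omega> x \<and> bdist \<Omega> x < s}"
proof -
  let ?r = "inradius \<Omega>"
  \<comment> \<open>Points of depth above \<open>?r/2\<close> are deeper than every admissible
    \<open>s\<close>. The bound \<open>?r + 1\<close>, larger than every depth, fits
    \<open>Q\<close> to \<open>open_bdist_between\<close>.\<close>
  define Q where "Q = {x\<in>\<Omega>. ?r/2 < bdist \<Omega> x \<and> bdist \<Omega> x < ?r + 1}"
  obtain e :: "real^'n" where e: "norm e = 1" using norm_axis_1 by blast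
  obtain M where M: "\<And>x. x \<in> \<Omega> \<Longrightarrow> norm x \<le> M" using bounded_domain by (auto simp: bounded_iff)
  \<comment> \<open>Larger than the diameter of \<Omega>, so that every ray starting in \<Omega> is
    outside at time \<open>D\<close>.\<close>
  define D where "D = 2 * \<bar>M\<bar> + 1"
  have D0: "D > 0" by (simp add: D_def)
  have exit: "x + D *\<^sub>R e \<notin> \<Omega>" if "x \<in> \<Omega>" for x
  proof
    assume "x + D *\<^sub>R e \<in> \<Omega>"
    then have "norm (D *\<^sub>R e) \<le> 2 * M"
      using M[OF that] M[of "x + D *\<^sub>R e"] norm_triangle_ineq4[of "x + D *\<^sub>R e" x] by simp
    then show False using e by (simp add: D_def)
  qed
  have Qopen: "open Q" "Q \<subseteq> \<Omega>" "Q \<noteq> {}"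
    unfolding Q_def using bdist_surj[of ?r] inradius_pos
    by (rule_tac open_bdist_between, blast, force)
  then have Qpos: "0 < measure lebesgue Q" by (intro measure_open_pos)
  have "measure lebesgue Q / (2 * D) * s
      \<le> measure lebesgue {x\<in>\<Omega>. s/2 < bdist \<Omega> x \<and> bdist \<Omega> x < s}" (is "_ \<le> measure _ ?A")
    if s: "0 < s" "s \<le> ?r/2" for s
  proof -
    define A where "A = ?A"
    have A: "open A" "A \<subseteq> \<Omega>" unfolding A_def by (rule open_bdist_between, blast)
    have [measurable]: "A \<in> sets borel" "Q \<in> sets borel" using A Qopen by auto
    let ?f = "\<lambda>x t. indicator Q x * (indicator {0..D} t * indicator A (x + t *\<^sub>R e)) :: ennreal"
    have fm: "(\<lambda>(x, t). ?f x t) \<in> borel_measurable (lborel \<Otimes>\<^sub>M lborel)"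
      by measurable
    have "ennreal (s/2) * emeasure lborel Q = (\<integral>\<^sup>+x. ennreal (s/2) * indicator Q x \<partial>lborel)"
      by (subst nn_integral_cmult_indicator) auto
    also have "\<dots> \<le> (\<integral>\<^sup>+x. (\<integral>\<^sup>+t. ?f x t \<partial>lborel) \<partial>lborel)"
    proof (rule nn_integral_mono)
      fix x :: "real^'n"
      show "ennreal (s/2) * indicator Q x \<le> (\<integral>\<^sup>+t. ?f x t \<partial>lborel)"
      proof (cases "x \<in> Q")
        case True
        then have "x \<in> \<Omega>" "s \<le> bdist \<Omega> x" using s by (auto simp: Q_def)
        then obtain t1 where t1: "{t1 - s/4<..<t1 + s/4} \<subseteq>
            {t. 0 \<le> t \<and> t \<le> D \<and> x + t *\<^sub>R e \<in> A}"
          using ray_in_shell[OF e, of x s D] exit[of x] s D0 unfolding A_def by auto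
        have "ennreal (s/2) = emeasure lborel {t1 - s/4<..<t1 + s/4}"
          using s by simp
        also have "\<dots> = (\<integral>\<^sup>+t. indicator {t1 - s/4<..<t1 + s/4} t \<partial>lborel)" by simp
        also have "\<dots> \<le> (\<integral>\<^sup>+t. ?f x t \<partial>lborel)"
          using t1 True by (intro nn_integral_mono) (auto simp: indicator_def)
        finally show ?thesis using True by simp
      qed auto
    qed
    also have "\<dots> = (\<integral>\<^sup>+t. (\<integral>\<^sup>+x. ?f x t \<partial>lborel) \<partial>lborel)"
      using lborel_pair.Fubini[OF fm] by simp
    \<comment> \<open>For fixed \<open>t\<close>, dropping the restriction to \<open>Q\<close>
      leaves a translate of \<open>A\<close>, which has the measure of \<open>A\<close>.\<close>
    also have "\<dots> \<le> (\<integral>\<^sup>+t. emeasure lborel A * indicator {0..D} t \<partial>lborel)"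
    proof (rule nn_integral_mono)
      fix t :: real
      have "(\<integral>\<^sup>+x. ?f x t \<partial>lborel) \<le> (\<integral>\<^sup>+x. indicator {0..D} t * indicator A (x + t *\<^sub>R e) \<partial>lborel)"
        by (intro nn_integral_mono) (auto simp: indicator_def)
      also have "\<dots> = indicator {0..D} t * emeasure lborel A"
        by (subst nn_integral_cmult) (auto simp: emeasure_lborel_plus_vimage)
      finally show "(\<integral>\<^sup>+x. ?f x t \<partial>lborel) \<le> emeasure lborel A * indicator {0..D} t"
        by (simp add: mult.commute)
    qed
    also have "\<dots> = emeasure lborel A * ennreal D"
      using D0 by (subst nn_integral_cmult_indicator) auto
    finally have *: "ennreal (s/2) * emeasure lborel Q \<le> emeasure lborel A * ennreal D" .
    have eq: "emeasure lborel V = ennreal (measure lebesgue V)" if "open V" "V \<subseteq> \<Omega>" for V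
      using emeasure_eq_measure2[OF lmeasurable_open_subset[OF that]] that(1) by simp
    have "ennreal (s/2 * measure lebesgue Q) \<le> ennreal (measure lebesgue A * D)"
      using * s(1) D0 unfolding eq[OF A] eq[OF Qopen(1,2)] by (subst (1 2) ennreal_mult) auto
    then have "s/2 * measure lebesgue Q \<le> measure lebesgue A * D"
      by (rule ennreal_le_iff[THEN iffD1, rotated]) (use D0 in auto)
    then show ?thesis using D0 by (simp add: A_def field_simps)
  qed
  moreover have "0 < measure lebesgue Q / (2 * D)" using Qpos D0 by simp
  ultimately show ?thesis by blast
qed

section \<open>Cubic bounds for \<open>I2\<close>\<close>

text \<open>On the shell of width \<sigma> = \<open>inradius \<Omega> * \<gamma>\<close> the depth
  is below \<sigma>, and on its half away from the frontier it exceeds \<sigma>/2; these bound the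
  integrand.\<close>

lemma
  assumes "0 \<le> \<gamma>"
  shows I2_le: "I2 \<Omega> \<gamma> \<le> (inradius \<Omega> * \<gamma>)\<^sup>2
      * measure lebesgue (\<Omega> - inner_parallel \<Omega> (inradius \<Omega> * \<gamma>))" (is ?up)
    and I2_ge: "(inradius \<Omega> * \<gamma> / 2)\<^sup>2 * measure lebesgue
      {x\<in>\<Omega>. inradius \<Omega> * \<gamma> / 2 < bdist \<Omega> x \<and> bdist \<Omega> x < inradius \<Omega> * \<gamma>} \<le> I2 \<Omega> \<gamma>" (is ?lo)
proof -
  define \<sigma> where "\<sigma> = inradius \<Omega> * \<gamma>"
  have \<sigma>: "0 \<le> \<sigma>" using assms inradius_pos by (simp add: \<sigma>_def)
  define S where "S = \<Omega> - inner_parallel \<Omega> \<sigma>"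
  let ?A = "{x\<in>\<Omega>. \<sigma>/2 < bdist \<Omega> x \<and> bdist \<Omega> x < \<sigma>}"
  have S: "S = {x\<in>\<Omega>. 0 < bdist \<Omega> x \<and> bdist \<Omega> x < \<sigma>}" using shell_eq S_def by simp
  have "open S" "S \<subseteq> \<Omega>" unfolding S using open_bdist_between by auto
  then have Sm: "S \<in> lmeasurable" by (rule lmeasurable_open_subset)
  have Am: "?A \<in> lmeasurable" by (rule lmeasurable_open_subset[OF open_bdist_between]) auto
  have int: "set_integrable lebesgue S (\<lambda>x. (bdist \<Omega> x)\<^sup>2)"
    unfolding set_integrable_def
  proof (rule Bochner_Integration.integrable_bound)
    show "integrable lebesgue (\<lambda>x. \<sigma>\<^sup>2 * indicator S x)"
      using Sm by (auto simp: fmeasurable_def)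
    show "(\<lambda>x. indicator S x *\<^sub>R (bdist \<Omega> x)\<^sup>2) \<in> borel_measurable lebesgue"
    proof -
      have "(\<lambda>x. (bdist \<Omega> x)\<^sup>2) \<in> borel_measurable borel"
        by (intro borel_measurable_continuous_onI continuous_intros continuous_bdist)
      then have "(\<lambda>x. (bdist \<Omega> x)\<^sup>2) \<in> borel_measurable lebesgue"
        by (intro measurable_completion) simp
      then show ?thesis using Sm by (intro borel_measurable_scaleR borel_measurable_indicator) auto
    qed
    show "AE x in lebesgue. norm (indicator S x *\<^sub>R (bdist \<Omega> x)\<^sup>2) \<le> norm (\<sigma>\<^sup>2 * indicator S x)"
      by (intro AE_I2) (auto simp: S indicator_def intro!: power_mono)
  qed
  have I2: "I2 \<Omega> \<gamma> = (LINT x|lebesgue. indicator S x *\<^sub>R (bdist \<Omega> x)\<^sup>2)"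
    by (simp add: I2_def S_def \<sigma>_def set_lebesgue_integral_def)
  have "I2 \<Omega> \<gamma> \<le> (LINT x|lebesgue. \<sigma>\<^sup>2 * indicator S x)"
    unfolding I2
  proof (rule integral_mono)
    show "integrable lebesgue (\<lambda>x. indicator S x *\<^sub>R (bdist \<Omega> x)\<^sup>2)"
      using int by (simp add: set_integrable_def)
    show "integrable lebesgue (\<lambda>x. \<sigma>\<^sup>2 * indicator S x)"
      using Sm by (auto simp: fmeasurable_def)
    show "indicator S x *\<^sub>R (bdist \<Omega> x)\<^sup>2 \<le> \<sigma>\<^sup>2 * indicator S x" for x
      by (auto simp: S indicator_def intro!: power_mono)
  qed
  also have "\<dots> = \<sigma>\<^sup>2 * measure lebesgue S" using Sm by simp
  finally show ?up by (simp add: S_def \<sigma>_def)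
  have "(\<sigma>/2)\<^sup>2 * measure lebesgue ?A = (LINT x|lebesgue. (\<sigma>/2)\<^sup>2 * indicator ?A x)"
    using Am by simp
  also have "\<dots> \<le> I2 \<Omega> \<gamma>"
    unfolding I2
  proof (rule integral_mono)
    show "integrable lebesgue (\<lambda>x. (\<sigma>/2)\<^sup>2 * indicator ?A x)"
      using Am by (auto simp: fmeasurable_def)
    show "integrable lebesgue (\<lambda>x. indicator S x *\<^sub>R (bdist \<Omega> x)\<^sup>2)"
      using int by (simp add: set_integrable_def)
    show "(\<sigma>/2)\<^sup>2 * indicator ?A x \<le> indicator S x *\<^sub>R (bdist \<Omega> x)\<^sup>2" for x
    proof (cases "x \<in> ?A")
      case True
      then have "x \<in> S" using \<sigma> by (auto simp: S)
      moreover have "(\<sigma>/2)\<^sup>2 \<le> (bdist \<Omega> x)\<^sup>2" using True \<sigma> by (intro power_mono) auto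
      ultimately show ?thesis using True by simp
    qed auto
  qed
  finally show ?lo by (simp add: \<sigma>_def)
qed

text \<open>Turns the condition \<open>I2 \<Omega> (g t) \<noteq> 0\<close> of
  \<open>solves_ode\<close> into \<open>g t \<noteq> 0\<close>.\<close>

lemma I2_0: "I2 \<Omega> 0 = 0"
proof -
  have "\<Omega> - inner_parallel \<Omega> 0 = {}" unfolding shell_eq by auto
  then show ?thesis
    by (simp only: I2_def mult_zero_right) (simp add: set_lebesgue_integral_def)
qed

text \<open>Two factors \<gamma> come from the squared depth, the third from the volume of the
  shell. The limit 1/2 keeps the width within the range of \<open>measure_shell_ge\<close>.\<close>

lemma I2_ge_cube:
  "\<exists>c>0. \<forall>\<gamma>. 0 < \<gamma> \<and> \<gamma> \<le> 1/2 \<longrightarrow> c * \<gamma>^3 \<le> I2 \<Omega> \<gamma>"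
proof -
  let ?r = "inradius \<Omega>"
  obtain c where c: "c > 0" and le: "\<And>s. 0 < s \<Longrightarrow> s \<le> ?r / 2 \<Longrightarrow>
     c * s \<le> measure lebesgue {x\<in>\<Omega>. s/2 < bdist \<Omega> x \<and> bdist \<Omega> x < s}"
    using measure_shell_ge by blast
  have "(c * ?r^3 / 4) * \<gamma>^3 \<le> I2 \<Omega> \<gamma>" if \<gamma>: "0 < \<gamma>" "\<gamma> \<le> 1/2" for \<gamma>
  proof -
    have "?r * \<gamma> \<le> ?r / 2" using mult_left_mono[OF \<gamma>(2), of ?r] inradius_pos by simp
    then have "(?r * \<gamma> / 2)\<^sup>2 * (c * (?r * \<gamma>)) \<le> I2 \<Omega> \<gamma>"
      using \<gamma> inradius_pos by (intro order_trans[OF mult_left_mono[OF le] I2_ge]) auto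
    then show ?thesis by (simp add: power2_eq_square power3_eq_cube mult_ac)
  qed
  moreover have "0 < c * ?r^3 / 4" using c inradius_pos by simp
  ultimately show ?thesis by blast
qed

text \<open>As in the lower bound, with the third factor \<gamma> now supplied by the assumed linear
  volume bound, valid for \<open>?r * \<gamma> < b\<close>.\<close>

lemma I2_le_cube:
  assumes "(\<lambda>s. measure lebesgue (\<Omega> - inner_parallel \<Omega> s)) \<in> O[at_right 0](\<lambda>s. s)"
  shows "\<exists>C>0. \<exists>\<gamma>0>0. \<forall>\<gamma>. 0 < \<gamma> \<and> \<gamma> < \<gamma>0 \<longrightarrow> I2 \<Omega> \<gamma> \<le> C * \<gamma>^3"
proof -
  let ?r = "inradius \<Omega>"
  obtain C where C: "C > 0"
    "eventually (\<lambda>s. norm (measure lebesgue (\<Omega> - inner_parallel \<Omega> s)) \<le> C * norm s) (at_right 0)"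
    using assms by (elim landau_o.bigE)
  then obtain b where b: "b > 0" and le: "\<And>s. 0 < s \<Longrightarrow> s < b \<Longrightarrow>
      measure lebesgue (\<Omega> - inner_parallel \<Omega> s) \<le> C * s"
    by (auto simp: eventually_at_right_field)
  have "I2 \<Omega> \<gamma> \<le> (C * ?r^3) * \<gamma>^3" if \<gamma>: "0 < \<gamma>" "\<gamma> < b / ?r" for \<gamma>
  proof -
    have "?r * \<gamma> < b" using \<gamma> inradius_pos by (simp add: field_simps)
    then have "I2 \<Omega> \<gamma> \<le> (?r * \<gamma>)\<^sup>2 * (C * (?r * \<gamma>))"
      using \<gamma> inradius_pos by (intro order_trans[OF I2_le mult_left_mono[OF le]]) auto
    then show ?thesis by (simp add: power2_eq_square power3_eq_cube mult_ac)
  qed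
  moreover have "0 < C * ?r^3" "0 < b / ?r" using C b inradius_pos by auto
  ultimately show ?thesis by blast
qed

section \<open>The solution \<open>g\<close> near 0 and at \<open>ts\<close>\<close>

lemma solves_ode_pos:
  assumes "solves_ode \<Omega> ts g g'" "0 < t" "t \<le> ts"
  shows "0 < g t"
proof -
  have "0 \<le> g t" "I2 \<Omega> (g t) \<noteq> 0" using assms by (auto simp: solves_ode_def)
  then show ?thesis using I2_0 by (cases "g t = 0") auto
qed

lemma solves_ode_bigtheta:
  assumes ts: "0 < ts" and ode: "solves_ode \<Omega> ts g g'"
    and meas: "(\<lambda>s. measure lebesgue (\<Omega> - inner_parallel \<Omega> s)) \<in> O[at_right 0](\<lambda>s. s)"
  shows "g' \<in> \<Theta>[at_right 0](\<lambda>t. 1 / sqrt t)"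
proof -
  obtain c where c: "c > 0" "\<And>\<gamma>. 0 < \<gamma> \<Longrightarrow> \<gamma> \<le> 1/2 \<Longrightarrow> c * \<gamma>^3 \<le> I2 \<Omega> \<gamma>"
    using I2_ge_cube by blast
  obtain C \<gamma>0 where C: "C > 0" "\<gamma>0 > 0" "\<And>\<gamma>. 0 < \<gamma> \<Longrightarrow> \<gamma> < \<gamma>0 \<Longrightarrow> I2 \<Omega> \<gamma> \<le> C * \<gamma>^3"
    using I2_le_cube[OF meas] by blast
  have g: "g 0 = 0" "continuous_on {0..ts} g" using ode by (auto simp: solves_ode_def)
  \<comment> \<open>Continuity at 0 keeps \<open>g\<close> below both thresholds for small times, so
    both cubic bounds apply.\<close>
  have "0 < min (1/2) \<gamma>0" using C by simp
  then obtain \<delta> where \<delta>: "\<delta> > 0"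
      "\<And>t. t \<in> {0..ts} \<Longrightarrow> dist t 0 < \<delta> \<Longrightarrow> dist (g t) (g 0) < min (1/2) \<gamma>0"
    using g(2) ts unfolding continuous_on_iff
    by (metis atLeastAtMost_iff less_eq_real_def order_refl)
  define T where "T = min ts \<delta>"
  have T: "0 < T" "T \<le> ts" "T \<le> \<delta>" using ts \<delta> by (auto simp: T_def)
  have small: "0 < g t" "g t < 1/2" "g t < \<gamma>0" if "0 < t" "t < T" for t
    using solves_ode_pos[OF ode, of t] \<delta>(2)[of t] that T g(1) by (auto simp: dist_real_def)
  have gg: "1 / C \<le> g t * g' t" "g t * g' t \<le> 1 / c" if t: "0 < t" "t < T" for t
  proof -
    have eq: "g' t = (g t)\<^sup>2 / I2 \<Omega> (g t)" using ode t T by (auto simp: solves_ode_def)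
    have lo: "c * (g t)^3 \<le> I2 \<Omega> (g t)" and up: "I2 \<Omega> (g t) \<le> C * (g t)^3"
      using c C small[OF t] by auto
    have "0 < c * (g t)^3" using c small[OF t] by simp
    then have "0 < I2 \<Omega> (g t)" using lo by linarith
    then show "1 / C \<le> g t * g' t" "g t * g' t \<le> 1 / c"
      using lo up c(1) C(1)
      by (auto simp: eq field_simps power2_eq_square power3_eq_cube)
  qed
  show ?thesis
  proof (rule bigtheta_inverse_sqrt_of_ode[where g = g and T = T and p = "1/C" and q = "1/c"])
    show "continuous_on {0..T} g" using g(2) T by (rule_tac continuous_on_subset) auto
    show "(g has_real_derivative g' t) (at t)" if t: "0 < t" "t < T" for t
    proof -
      have "at t within {0..ts} = at t" using t T by (intro at_within_interior) auto
      then show ?thesis using ode t T unfolding solves_ode_def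
        by (metis greaterThanAtMost_iff less_le_trans less_imp_le)
    qed
    show "0 < 1 / C" using C by simp
  qed (use T g small gg in auto)
qed

lemma flow_at_ts:
  assumes "0 < ts"
  shows "flow \<Omega> ts g ts x = bdist \<Omega> x"
  using assms L2_norm_bdist_pos by (simp add: flow_def)

text \<open>At \<open>ts\<close> the flow equals \<open>bdist \<Omega>\<close>. If
  \<open>g ts < 1\<close>, then just before \<open>ts\<close> the first branch would exceed
  \<open>bdist \<Omega>\<close> by a fixed amount on a set of positive measure, contradicting
  continuity.\<close>

lemma solves_ode_at_ts:
  assumes ts: "0 < ts" and ode: "solves_ode \<Omega> ts g g'"
    and cont: "L2_continuous_on \<Omega> {0..} (flow \<Omega> ts g)"
  shows "g ts = 1"
proof (rule ccontr)
  assume "g ts \<noteq> 1"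
  moreover have "g ts \<le> 1" using ode ts by (auto simp: solves_ode_def)
  ultimately have "g ts < 1" by simp
  then obtain \<gamma> where \<gamma>: "g ts < \<gamma>" "\<gamma> < 1" using dense by blast
  have \<gamma>0: "0 < \<gamma>" using solves_ode_pos[OF ode ts] \<gamma> by simp
  let ?r = "inradius \<Omega>"
  let ?V = "{x\<in>\<Omega>. ?r/4 < bdist \<Omega> x \<and> bdist \<Omega> x < 3 * ?r / 4}"
  \<comment> \<open>The two gaps on \<open>?V\<close>: depth at least \<open>?r/4\<close> bounds
    \<open>1 / g s * bdist \<Omega> x - bdist \<Omega> x\<close> from below, depth at most
    \<open>3 * ?r / 4\<close> bounds \<open>?r - bdist \<Omega> x\<close>.\<close>
  define \<delta> where "\<delta> = min ((1/\<gamma> - 1) * (?r/4)) (?r/4)"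
  have "1 / \<gamma> - 1 > 0" using \<gamma> \<gamma>0 by (simp add: field_simps)
  then have \<delta>: "\<delta> > 0" using inradius_pos by (simp add: \<delta>_def)
  have "?V \<noteq> {}" using bdist_surj[of "?r/2"] inradius_pos by force
  then have V: "0 < measure lebesgue ?V"
    by (intro measure_open_pos open_bdist_between) auto
  have far: "\<delta> * sqrt (measure lebesgue ?V) \<le> L2_norm \<Omega> (\<lambda>x. flow \<Omega> ts g s x - flow \<Omega> ts g ts x)"
    if s: "0 < s" "s < ts" "g s < \<gamma>" for s
  proof -
    have gs: "0 < g s" "g s \<le> 1"
      using solves_ode_pos[OF ode, of s] s ode by (auto simp: solves_ode_def)
    have eq: "(\<lambda>x. flow \<Omega> ts g s x - flow \<Omega> ts g ts x)
        = (\<lambda>x. min (1 / g s * bdist \<Omega> x) ?r - bdist \<Omega> x)"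
      using s ts by (auto simp: flow_at_ts) (auto simp: flow_def)
    show ?thesis unfolding eq
    proof (rule L2_norm_ge[where B = ?r])
      show "continuous_on \<Omega> (\<lambda>x. min (1 / g s * bdist \<Omega> x) ?r - bdist \<Omega> x)"
        by (intro continuous_intros continuous_bdist)
      show "\<bar>min (1 / g s * bdist \<Omega> x) ?r - bdist \<Omega> x\<bar> \<le> ?r" if "x \<in> \<Omega>" for x
      proof -
        have "0 \<le> 1 / g s * bdist \<Omega> x" using gs bdist_pos[OF that] by simp
        then show ?thesis using bdist_pos[OF that] bdist_le_inradius[OF that] by auto
      qed
      show "\<delta> \<le> \<bar>min (1 / g s * bdist \<Omega> x) ?r - bdist \<Omega> x\<bar>" if x: "x \<in> ?V" for x
      proof -
        have d: "0 < bdist \<Omega> x" using x bdist_pos by auto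
        have "(1/\<gamma> - 1) * (?r/4) \<le> (1/\<gamma> - 1) * bdist \<Omega> x"
          using x \<open>1 / \<gamma> - 1 > 0\<close> by (intro mult_left_mono) auto
        also have "\<dots> \<le> (1 / g s - 1) * bdist \<Omega> x"
          using d gs s \<gamma>0 by (intro mult_right_mono diff_right_mono frac_le) auto
        finally have "(1/\<gamma> - 1) * (?r/4) \<le> 1 / g s * bdist \<Omega> x - bdist \<Omega> x"
          by (simp add: algebra_simps)
        moreover have "?r/4 \<le> ?r - bdist \<Omega> x" using x by auto
        ultimately show ?thesis unfolding \<delta>_def by linarith
      qed
    qed (rule open_bdist_between, use \<delta> in auto)
  qed
  have "((\<lambda>s. L2_norm \<Omega> (\<lambda>x. flow \<Omega> ts g s x - flow \<Omega> ts g ts x)) \<longlongrightarrow> 0) (at ts within {0..})"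
    using cont ts by (auto simp: L2_continuous_on_def)
  \<comment> \<open>Only times before \<open>ts\<close> are kept, where the first branch of
    \<open>flow\<close> is in force.\<close>
  then have "((\<lambda>s. L2_norm \<Omega> (\<lambda>x. flow \<Omega> ts g s x - flow \<Omega> ts g ts x)) \<longlongrightarrow> 0) (at ts within {0<..<ts})"
    by (rule tendsto_within_subset) auto
  then have e1: "eventually (\<lambda>s. L2_norm \<Omega> (\<lambda>x. flow \<Omega> ts g s x - flow \<Omega> ts g ts x)
      < \<delta> * sqrt (measure lebesgue ?V)) (at ts within {0<..<ts})"
    using \<delta> V by (intro order_tendstoD(2)) auto
  have "(g \<longlongrightarrow> g ts) (at ts within {0..ts})"
    using ode ts by (auto simp: solves_ode_def continuous_on_def)
  then have "(g \<longlongrightarrow> g ts) (at ts within {0<..<ts})"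
    by (rule tendsto_within_subset) auto
  then have e2: "eventually (\<lambda>s. g s < \<gamma>) (at ts within {0<..<ts})"
    using \<gamma> by (intro order_tendstoD(2))
  have e3: "eventually (\<lambda>s. s \<in> {0<..<ts}) (at ts within {0<..<ts})"
    by (simp add: eventually_at_filter)
  have "eventually (\<lambda>s. False) (at ts within {0<..<ts})"
    using e1 e2 e3 by eventually_elim (use far in force)
  moreover have "at ts within {0<..<ts} \<noteq> bot"
    using ts by (simp add: at_within_eq_bot_iff islimpt_greaterThanLessThan2 trivial_limit_within)
  ultimately show False by (simp add: trivial_limit_def)
qed

end

section \<open>Level sets of the flow and their velocity\<close>

text \<open>The velocity is expressed as the time derivative of the distance between the level set
  and the frontier. The relation of \<open>g'\<close> to \<open>1 / sqrt t\<close> is two-sided up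
  to constants, under a linear bound on the volume of thin boundary shells.\<close>

theorem corollary3p7:
  fixes \<Omega> :: "(real^'n) set" and r ts :: real and g g' :: "real \<Rightarrow> real"
    and u :: "real \<Rightarrow> real^'n \<Rightarrow> real"
  assumes "open \<Omega>" and "bounded \<Omega>" and "connected \<Omega>" and "\<Omega> \<noteq> {}"
    and "admits_perimeter_bound \<Omega>"
    and "r = inradius \<Omega>"
    and "ts > 0"
    and "solves_ode \<Omega> ts g g'"
    and "u = flow \<Omega> ts g"
    and "solves_gradient_flow \<Omega> (J_functional \<Omega>) (\<lambda>x. r) u"
  shows "(\<forall>t\<in>{0..ts}. \<forall>c\<in>{0..<r}. level_set \<Omega> (u t) c = {x\<in>\<Omega>. bdist \<Omega> x = c * g t})
    \<and> (\<forall>t\<in>{0..ts}. level_set \<Omega> (u t) r = {x\<in>\<Omega>. bdist \<Omega> x \<ge> r * g t})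
    \<and> (\<forall>t\<in>{0<..ts}. \<forall>c\<in>{0<..r}.
         ((\<lambda>s. setdist (level_set \<Omega> (u s) c) (frontier \<Omega>)) has_real_derivative c * g' t)
           (at t within {0..ts}))
    \<and> ((\<lambda>s. measure lebesgue (\<Omega> - inner_parallel \<Omega> s)) \<in> O[at_right 0](\<lambda>s. s)
         \<longrightarrow> g' \<in> \<Theta>[at_right 0](\<lambda>t. 1 / sqrt t))"
proof -
  interpret bounded_domain \<Omega> using assms(1-4) by unfold_locales
  note ts = assms(7) and ode = assms(8)
  have r: "r = inradius \<Omega>" "0 < r" using assms(6) inradius_pos by auto
  have g0: "g 0 = 0" and gle: "\<And>t. t \<in> {0..ts} \<Longrightarrow> g t \<le> 1"
    using ode by (auto simp: solves_ode_def)
  have gts: "g ts = 1"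
    using assms(9,10) by (intro solves_ode_at_ts[OF ts ode]) (auto simp: solves_gradient_flow_def)
  \<comment> \<open>Since \<open>g ts = 1\<close> and depths are at most \<open>r\<close>, the first
    formula extends to \<open>t = ts\<close>.\<close>
  have u: "u t x = min (1 / g t * bdist \<Omega> x) r" if "0 < t" "t \<le> ts" "x \<in> \<Omega>" for t x
    using that gts ts flow_at_ts[OF ts] bdist_le_inradius[of x]
    by (cases "t = ts") (auto simp: assms(9) r flow_def)
  have u0: "u 0 x = r" for x by (simp add: assms(9) flow_def r)
  have L: "level_set \<Omega> (u t) c = {x\<in>\<Omega>. bdist \<Omega> x = c * g t}"
    if "t \<in> {0..ts}" "c \<in> {0..<r}" for t c
  proof (cases "t = 0")
    \<comment> \<open>Both sets are empty: \<open>u 0\<close> equals \<open>r > c\<close>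
      everywhere, and no point of \<Omega> has depth 0.\<close>
    case True
    then show ?thesis using that u0 g0 bdist_pos by (force simp: level_set_def)
  next
    case False
    then have "0 < t" "t \<le> ts" using that by auto
    have gt: "0 < g t" using solves_ode_pos[OF ode] \<open>0 < t\<close> \<open>t \<le> ts\<close> by simp
    have "u t x = c \<longleftrightarrow> 1 / g t * bdist \<Omega> x = c" if "x \<in> \<Omega>" for x
      using u[OF \<open>0 < t\<close> \<open>t \<le> ts\<close> that] \<open>c \<in> {0..<r}\<close> by (auto simp: min_def)
    then show ?thesis using gt by (auto simp: level_set_def field_simps)
  qed
  have Lr: "level_set \<Omega> (u t) r = {x\<in>\<Omega>. bdist \<Omega> x \<ge> r * g t}" if "t \<in> {0..ts}" for t
  proof (cases "t = 0")
    case True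
    then show ?thesis using u0 g0 bdist_pos by (force simp: level_set_def)
  next
    case False
    then have "0 < t" "t \<le> ts" using that by auto
    have gt: "0 < g t" using solves_ode_pos[OF ode] \<open>0 < t\<close> \<open>t \<le> ts\<close> by simp
    have "u t x = r \<longleftrightarrow> r \<le> 1 / g t * bdist \<Omega> x" if "x \<in> \<Omega>" for x
      using u[OF \<open>0 < t\<close> \<open>t \<le> ts\<close> that] by (auto simp: min_def)
    then show ?thesis using gt by (auto simp: level_set_def field_simps)
  qed
  have dist: "setdist (level_set \<Omega> (u s) c) (frontier \<Omega>) = c * g s"
    if s: "s \<in> {0..ts}" and c: "c \<in> {0<..r}" for s c
  proof (cases "s = 0")
    case True
    \<comment> \<open>For \<open>c < r\<close> the level set is empty, and \<open>setdist\<close> of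
      an empty set is 0 by convention, which agrees with \<open>c * g 0\<close>.\<close>
    have "level_set \<Omega> (u 0) c = (if c = r then \<Omega> else {})"
      using u0 by (auto simp: level_set_def)
    then show ?thesis using True g0 setdist_domain_frontier by simp
  next
    case False
    then have gs: "0 < g s" "g s \<le> 1" using solves_ode_pos[OF ode, of s] gle s by auto
    \<comment> \<open>Keeps \<open>c * g s\<close> among the depths that occur in \<Omega>, so the
      distance is attained.\<close>
    have "c * g s \<le> r"
      using mult_mono[of c r "g s" 1] gs c by auto
    then obtain x where "x \<in> \<Omega>" "bdist \<Omega> x = c * g s"
      using bdist_surj[of "c * g s"] gs c r by auto
    then show ?thesis
      using L[OF s, of c] Lr[OF s] c by (cases "c = r") (auto intro!: setdist_frontier_eq)
  qed
  have "((\<lambda>s. setdist (level_set \<Omega> (u s) c) (frontier \<Omega>)) has_real_derivative c * g' t)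
           (at t within {0..ts})" if t: "t \<in> {0<..ts}" and c: "c \<in> {0<..r}" for t c
  \<comment> \<open>By \<open>dist\<close> the two functions agree on all of \<open>{0..ts}\<close>,
    so any positive radius \<open>d\<close> would do.\<close>
  proof (rule has_field_derivative_transform_within[where f = "\<lambda>s. c * g s" and d = 1])
    show "((\<lambda>s. c * g s) has_real_derivative c * g' t) (at t within {0..ts})"
      using ode t unfolding solves_ode_def by (intro DERIV_cmult) blast
  qed (use t c dist in auto)
  then show ?thesis using L Lr solves_ode_bigtheta[OF ts ode] by blast
qed

end
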